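(* Let $\nu\ge1$, $s\ge 1$, $t\ge 0$, $n\ge0$ be integers, let $\bm{t}=(t_1,\dots,t_s)$ be a generalized ordered partition of $t$, i.e. a sequence of integers $t_i\ge 0$ with $t_1+\cdots+t_s=t$, and let $\mathbf{1}=(1,\dots,1)$ (with $s$ entries). Then the family of $(\nu+1,\bm{t}+\mathbf{1})$-ary increasing $(s,[n])$-forests is in natural bijection with the class of $(\nu,\bm{t},n)$-Stirling permutations.
   Context: Write $[n]=\{1,\dots,n\}$ (with $[0]=\emptyset$). A generalized ordered partition $(X_1,\dots,X_s)$ of $[n]$ is a sequence of pairwise disjoint, possibly empty, subsets with union $[n]$. **Stirling permutations.** For integers $\nu\ge1$, $t\ge0$ and a finite set $X=\{x_1<\dots<x_m\}$ of positive integers, put $x_0=0$. A $(\nu,t,X)$-Stirling permutation is a permutation (arrangement as a word) of the multiset $\{0^t,x_1^\nu,\dots,x_m^\nu\}$ such that for each $0\le j\le m$ the elements occurring between two occurrences of $x_j$ are all at least $x_j$. (If $X=\emptyset$ the unique one is $0^t$, which is the empty word when $t=0$.) For $\bm{t}=(t_1,\dots,t_s)$ with integers $t_i\ge0$, a $(\nu,\bm{t},n)$-Stirling permutation is a sequence $(\rho_1,\dots,\rho_s)$ such that, for some generalized ordered partition $(X_1,\dots,X_s)$ of $[n]$, each $\rho_i$ is a $(\nu,t_i,X_i)$-Stirling permutation. **Trees and forests.** For integers $d\ge2$, $d_0\ge1$ and a finite set $X$ of positive integers, a $(d,d_0)$-ary increasing $X$-tree is a rooted tree whose internal vertices are labelled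 bijectively by $\{0\}\cup X$, whose root is labelled $0$, such that the labels along the path from the root to any internal vertex form an increasing sequence, and such that the root has $d_0$ labelled (ordered, left to right) positions for children and every other internal vertex has $d$ labelled (ordered) positions for children; each position is occupied by an internal vertex or by an external (unlabelled leaf) node. For $\mathbf{u}=(u_1,\dots,u_s)$ with integers $u_i\ge1$, a $(d,\mathbf{u})$-ary increasing $(s,[n])$-forest is an ordered forest $(T_1,\dots,T_s)$ such that, for some generalized ordered partition $(X_1,\dots,X_s)$ of $[n]$, each $T_i$ is a $(d,u_i)$-ary increasing $X_i$-tree. *)

theory Defs
  imports Main "HOL-Library.Multiset"
begin

text \<open>Sequences are lists, so indices run from \<open>0\<close>; parts may be empty.\<close>

definition gen_ordered_partition :: "nat \<Rightarrow> nat \<Rightarrow> nat set list \<Rightarrow> bool" where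
  "gen_ordered_partition s n Xs \<longleftrightarrow>
     length Xs = s \<and>
     (\<forall>i<s. \<forall>j<s. i \<noteq> j \<longrightarrow> Xs ! i \<inter> Xs ! j = {}) \<and>
     \<Union> (set Xs) = {1..n}"

text \<open>The parameter \<open>X\<close> is meant to be a finite set of positive integers, here and for trees below.\<close>

definition stirling_permutation :: "nat \<Rightarrow> nat \<Rightarrow> nat set \<Rightarrow> nat list \<Rightarrow> bool" where
  "stirling_permutation \<nu> t X w \<longleftrightarrow>
     mset w = replicate_mset t 0 + (\<Sum>x\<in>X. replicate_mset \<nu> x) \<and>
     (\<forall>x\<in>insert 0 X. \<forall>i k j. i < k \<and> k < j \<and> j < length w \<and> w ! i = x \<and> w ! j = x
        \<longrightarrow> x \<le> w ! k)"

definition stirling_permutations :: "nat \<Rightarrow> nat list \<Rightarrow> nat \<Rightarrow> nat list list set" where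
  "stirling_permutations \<nu> ts n =
     {\<rho>s. length \<rho>s = length ts \<and>
       (\<exists>Xs. gen_ordered_partition (length ts) n Xs \<and>
         (\<forall>i<length ts. stirling_permutation \<nu> (ts ! i) (Xs ! i) (\<rho>s ! i)))}"

text \<open>The list in \<open>Internal\<close> has one entry for each child position, from left to right.\<close>

datatype tree = External | Internal nat "tree list"

text \<open>One entry per internal vertex, in preorder.\<close>

fun labels :: "tree \<Rightarrow> nat list" where
  "labels External = []"
| "labels (Internal a cs) = a # concat (map labels cs)"

text \<open>The label sequences along the paths from the root to the internal vertices.\<close>

fun root_paths :: "tree \<Rightarrow> nat list set" where
  "root_paths External = {}"
| "root_paths (Internal a cs) = insert [a] ((#) a ` (\<Union>c\<in>set cs. root_paths c))"

fun full_ary :: "nat \<Rightarrow> tree \<Rightarrow> bool" where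
  "full_ary d External \<longleftrightarrow> True"
| "full_ary d (Internal a cs) \<longleftrightarrow> length cs = d \<and> (\<forall>c\<in>set cs. full_ary d c)"

text \<open>Distinctness of \<open>labels T\<close> says that different internal vertices have different labels.\<close>

definition increasing_tree :: "nat \<Rightarrow> nat \<Rightarrow> nat set \<Rightarrow> tree \<Rightarrow> bool" where
  "increasing_tree d d0 X T \<longleftrightarrow>
     (\<exists>cs. T = Internal 0 cs \<and> length cs = d0 \<and> (\<forall>c\<in>set cs. full_ary d c)) \<and>
     distinct (labels T) \<and> set (labels T) = insert 0 X \<and>
     (\<forall>p\<in>root_paths T. sorted_wrt (<) p)"

definition increasing_forests :: "nat \<Rightarrow> nat list \<Rightarrow> nat \<Rightarrow> tree list set" where
  "increasing_forests d us n =
     {Ts. length Ts = length us \<and>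
       (\<exists>Xs. gen_ordered_partition (length us) n Xs \<and>
         (\<forall>i<length us. increasing_tree d (us ! i) (Xs ! i) (Ts ! i)))}"

text \<open>
  The natural map from trees to words reads a tree in depth-first order, writing the label \<open>a\<close> of
  a vertex each time the walk passes from one child position of that vertex to the next:
  children \<open>c\<^sub>1, \<dots>, c\<^sub>k\<close> give \<open>w\<^sub>1 a w\<^sub>2 a \<dots> a w\<^sub>k\<close>, where \<open>w\<^sub>i\<close> is the word of \<open>c\<^sub>i\<close>.
  A vertex with \<open>k\<close> child positions thus contributes its label \<open>k - 1\<close> times.
\<close>

fun join_words :: "nat \<Rightarrow> nat list list \<Rightarrow> nat list" where
  "join_words a [] = []"
| "join_words a [w] = w"
| "join_words a (w # w' # ws) = w @ a # join_words a (w' # ws)"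

fun traversal_word :: "tree \<Rightarrow> nat list" where
  "traversal_word External = []"
| "traversal_word (Internal a cs) = join_words a (map traversal_word cs)"

end

theory Submission
  imports Defs
begin

text \<open>
  Cutting a word at all occurrences of its smallest letter \<open>a\<close> undoes one step of the traversal:
  if \<open>a\<close> occurs \<open>k\<close> times, then there are exactly \<open>k + 1\<close> blocks without \<open>a\<close> between and around
  these occurrences (\<open>ex_join_words\<close>, \<open>join_words_inject\<close>), and these blocks are the words of the
  \<open>k + 1\<close> children of a vertex labelled \<open>a\<close>.  The two sides carry matching conditions.  If two
  different blocks shared a letter \<open>x\<close>, then the letter \<open>a < x\<close> would lie between two occurrences
  of \<open>x\<close>; so the Stirling condition on the whole word says exactly that the blocks have
  pairwise disjoint letters and satisfy the Stirling condition themselves (\<open>nested_join_words\<close>).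
  Likewise a tree is increasing with distinct labels exactly if its children are, have pairwise
  disjoint label sets, and carry labels larger than that of the root (\<open>increasing_vertex_iff\<close>).
  Since the blocks have disjoint letters, every letter of a block occurs in it as often as in the whole
  word, namely \<open>\<nu>\<close> times, and the argument can be repeated inside each block.

  By recursion, a nested word in which every letter occurs \<open>\<nu>\<close> times is the word of exactly one
  increasing subtree all of whose internal vertices have \<open>\<nu> + 1\<close> child positions.  Here \<open>\<nu> \<ge> 1\<close> ensures that
  each label is visible in the word: the label set of a subtree is the letter set of its
  word, so the empty word comes from the external node only, and the root label of any other
  subtree is the least letter of its word.  The root of the whole tree is cut out in the same way,
  with \<open>a = 0\<close> and \<open>k = t\<close>; for \<open>t = 0\<close> the only block is the whole word, and this is why the
  cutting step (\<open>ex_increasing_children\<close>) allows a letter \<open>a\<close> that does not occur.  Forests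
  and sequences of words correspond entry by entry, with the same ordered partition.
\<close>

section \<open>Cutting a word at a letter\<close>

lemma mset_join_words:
  "ws \<noteq> [] \<Longrightarrow> mset (join_words a ws) = replicate_mset (length ws - 1) a + mset (concat ws)"
  by (induction a ws rule: join_words.induct) auto

lemma join_words_Cons: "ws \<noteq> [] \<Longrightarrow> join_words a (w # ws) = w @ a # join_words a ws"
  by (cases ws) auto

lemma ex_join_words:
  "\<exists>ws. ws \<noteq> [] \<and> join_words a ws = w \<and> (\<forall>u\<in>set ws. a \<notin> set u)"
proof (induction w)
  case Nil
  have "join_words a [[]] = []" by simp
  then show ?case by (intro exI[of _ "[[]]"]) auto
next
  case (Cons x w)
  then obtain u us where us: "join_words a (u # us) = w" "\<forall>v\<in>set (u # us). a \<notin> set v"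
    by (metis neq_Nil_conv)
  show ?case
  proof (cases "x = a")
    case True
    then show ?thesis using us by (intro exI[of _ "[] # u # us"]) simp
  next
    case False
    have "join_words a ((x # u) # us) = x # w" using us(1) by (cases us) simp_all
    moreover have "\<forall>v\<in>set ((x # u) # us). a \<notin> set v" using us(2) False by simp
    ultimately show ?thesis by blast
  qed
qed

lemma append_Cons_inject_first:
  "a \<notin> set u \<Longrightarrow> a \<notin> set v \<Longrightarrow> u @ a # x = v @ a # y \<longleftrightarrow> u = v \<and> x = y"
proof (induction u arbitrary: v)
  case Nil
  then show ?case by (cases v) auto
next
  case (Cons b u)
  then show ?case by (cases v) auto
qed

lemma join_words_inject:
  assumes "ws \<noteq> []" "vs \<noteq> []" "\<forall>u\<in>set ws. a \<notin> set u" "\<forall>u\<in>set vs. a \<notin> set u"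
    and "join_words a ws = join_words a vs"
  shows "ws = vs"
  using assms
proof (induction ws arbitrary: vs)
  case Nil
  then show ?case by simp
next
  case (Cons w ws)
  then obtain v vs' where vs: "vs = v # vs'" by (cases vs) auto
  have a: "a \<notin> set w" "a \<notin> set v" using Cons.prems(3,4) vs by simp_all
  have eq: "join_words a (w # ws) = join_words a (v # vs')" using Cons.prems(5) vs by simp
  consider "ws = []" "vs' = []" | "ws = []" "vs' \<noteq> []" | "ws \<noteq> []" "vs' = []"
    | "ws \<noteq> []" "vs' \<noteq> []" by blast
  then show ?case
  proof cases
    case 1
    then show ?thesis using eq vs by simp
  next
    case 2
    then have "w = v @ a # join_words a vs'" using eq by (simp add: join_words_Cons)
    then show ?thesis using a(1) by simp
  next
    case 3
    then have "w @ a # join_words a ws = v" using eq by (simp add: join_words_Cons)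
    then show ?thesis using a(2) by auto
  next
    case 4
    then have "w @ a # join_words a ws = v @ a # join_words a vs'"
      using eq by (simp add: join_words_Cons)
    then have wv: "w = v" and tails: "join_words a ws = join_words a vs'"
      unfolding append_Cons_inject_first[OF a] by simp_all
    have "ws = vs'" using 4 tails Cons.prems(3,4) vs by (intro Cons.IH) simp_all
    then show ?thesis using vs wv by simp
  qed
qed

abbreviation disjoint_words :: "nat list list \<Rightarrow> bool" where
  "disjoint_words \<equiv> sorted_wrt (\<lambda>u v. set u \<inter> set v = {})"

text \<open>This passes the multiplicity \<open>\<nu>\<close> of the letters from a word to its blocks.\<close>

lemma count_concat_disjoint_words:
  assumes "disjoint_words ws" "u \<in> set ws" "x \<in> set u"
  shows "count (mset (concat ws)) x = count (mset u) x"
  using assms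
proof (induction ws)
  case (Cons w ws)
  show ?case
  proof (cases "x \<in> set w")
    case True
    then have "x \<notin> set (concat ws)" using Cons.prems by auto
    then have "count (mset (concat ws)) x = 0" by (metis count_mset_0_iff)
    moreover have "u = w" using Cons.prems True \<open>x \<notin> set (concat ws)\<close> by auto
    ultimately show ?thesis by simp
  next
    case False
    then have "count (mset w) x = 0" by simp
    then show ?thesis using Cons False by auto
  qed
qed simp

lemma distinct_concat_iff_disjoint_words:
  "distinct (concat ws) \<longleftrightarrow> (\<forall>w\<in>set ws. distinct w) \<and> disjoint_words ws"
proof (induction ws)
  case (Cons w ws)
  have "set w \<inter> set (concat ws) = {} \<longleftrightarrow> (\<forall>v\<in>set ws. set w \<inter> set v = {})" by auto
  then show ?case using Cons by (auto simp del: set_concat)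
qed simp

section \<open>The nesting condition\<close>

text \<open>
  The order condition of Stirling permutations, in a form recursive in the word.  For the first
  letter \<open>x\<close> it says that no \<open>x\<close> comes after the first letter smaller than \<open>x\<close>.  Letters are not
  restricted to a given set here, so that the condition passes to blocks.
\<close>

fun nested :: "nat list \<Rightarrow> bool" where
  "nested [] \<longleftrightarrow> True"
| "nested (x # w) \<longleftrightarrow> x \<notin> set (dropWhile ((\<le>) x) w) \<and> nested w"

lemma notin_set_dropWhile_iff:
  assumes "P x"
  shows "x \<notin> set (dropWhile P w) \<longleftrightarrow> (\<forall>k j. k < j \<and> j < length w \<and> w ! j = x \<longrightarrow> P (w ! k))"
    (is "_ \<longleftrightarrow> ?R w")
proof (induction w)
  case (Cons y w)
  have "?R (y # w) \<longleftrightarrow> (x \<in> set w \<longrightarrow> P y) \<and> ?R w" (is "_ \<longleftrightarrow> ?A \<and> _")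
  proof
    assume R: "?R (y # w)"
    have ?A
    proof
      assume "x \<in> set w"
      then obtain j where "j < length w" "w ! j = x" by (auto simp: in_set_conv_nth)
      then show "P y" using R[rule_format, of 0 "Suc j"] by auto
    qed
    moreover have "?R w"
    proof (intro allI impI)
      fix k j assume "k < j \<and> j < length w \<and> w ! j = x"
      then show "P (w ! k)" using R[rule_format, of "Suc k" "Suc j"] by auto
    qed
    ultimately show "?A \<and> ?R w" ..
  next
    assume AR: "?A \<and> ?R w"
    show "?R (y # w)"
    proof (intro allI impI)
      fix k j assume *: "k < j \<and> j < length (y # w) \<and> (y # w) ! j = x"
      then obtain j' where "j = Suc j'" by (metis less_imp_Suc_add)
      then show "P ((y # w) ! k)" using * AR by (cases k) auto
    qed
  qed
  moreover have "x \<notin> set w \<Longrightarrow> ?R w" by auto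
  ultimately show ?case using Cons.IH assms by auto
qed simp

lemma nested_iff_nth:
  "nested w \<longleftrightarrow> (\<forall>i k j. i < k \<and> k < j \<and> j < length w \<and> w ! i = w ! j \<longrightarrow> w ! i \<le> w ! k)"
proof (induction w)
  case (Cons x w)
  have "(\<forall>i k j. i < k \<and> k < j \<and> j < length (x # w) \<and> (x # w) ! i = (x # w) ! j \<longrightarrow> (x # w) ! i \<le> (x # w) ! k)
    \<longleftrightarrow> (\<forall>k j. k < j \<and> j < length w \<and> w ! j = x \<longrightarrow> x \<le> w ! k) \<and>
      (\<forall>i k j. i < k \<and> k < j \<and> j < length w \<and> w ! i = w ! j \<longrightarrow> w ! i \<le> w ! k)" (is "?L \<longleftrightarrow> ?A \<and> ?B")
  proof
    assume L: ?L
    have ?A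
    proof (intro allI impI)
      fix k j assume "k < j \<and> j < length w \<and> w ! j = x"
      then show "x \<le> w ! k" using L[rule_format, of 0 "Suc k" "Suc j"] by auto
    qed
    moreover have ?B
    proof (intro allI impI)
      fix i k j assume "i < k \<and> k < j \<and> j < length w \<and> w ! i = w ! j"
      then show "w ! i \<le> w ! k" using L[rule_format, of "Suc i" "Suc k" "Suc j"] by auto
    qed
    ultimately show "?A \<and> ?B" ..
  next
    assume AB: "?A \<and> ?B"
    show ?L
    proof (intro allI impI)
      fix i k j
      assume *: "i < k \<and> k < j \<and> j < length (x # w) \<and> (x # w) ! i = (x # w) ! j"
      then obtain k' j' where "k = Suc k'" "j = Suc j'" by (metis less_imp_Suc_add)
      then show "(x # w) ! i \<le> (x # w) ! k" using * AB by (cases i) auto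
    qed
  qed
  then show ?case using Cons.IH notin_set_dropWhile_iff[of "(\<le>) x" x w] by simp
qed simp

text \<open>
  For a letter \<open>x\<close> of \<open>u\<close>, the part of the word after \<open>x\<close> that is at least \<open>x\<close> ends at the
  latest at \<open>a\<close>; so the condition on \<open>x\<close> concerns \<open>u\<close> alone, except that \<open>x\<close> must not occur in
  \<open>v\<close>.  The letter \<open>a\<close> itself may occur in \<open>v\<close> again, since nothing there is smaller.
\<close>

lemma nested_append_Cons:
  assumes "\<forall>y\<in>set u. a < y" "\<forall>y\<in>set v. a \<le> y"
  shows "nested (u @ a # v) \<longleftrightarrow> nested u \<and> nested v \<and> set u \<inter> set v = {}"
  using assms
proof (induction u)
  case Nil
  then have "dropWhile ((\<le>) a) v = []" by simp
  note * = this
  show ?case by (simp add: *)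
next
  case (Cons x u)
  have "dropWhile ((\<le>) x) (u @ a # v) = dropWhile ((\<le>) x) u @ a # v"
    using Cons.prems(1) by (induction u) auto
  then show ?case using Cons by auto
qed

lemma nested_join_words:
  assumes "ws \<noteq> []" "\<forall>u\<in>set ws. \<forall>y\<in>set u. a < y"
  shows "nested (join_words a ws) \<longleftrightarrow> (\<forall>u\<in>set ws. nested u) \<and> disjoint_words ws"
  using assms
proof (induction ws)
  case (Cons w ws)
  show ?case
  proof (cases "ws = []")
    case False
    have 1: "set (join_words a ws) - {a} = set (concat ws)"
    proof -
      have "set (join_words a ws) = set_mset (replicate_mset (length ws - 1) a + mset (concat ws))"
        using mset_join_words[OF False, of a] by (metis set_mset_mset)
      moreover have "a \<notin> set (concat ws)" using Cons.prems by auto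
      ultimately show ?thesis by auto
    qed
    have "a \<notin> set w" using Cons.prems by auto
    then have "set w \<inter> set (join_words a ws) = set w \<inter> set (concat ws)" using 1 by blast
    then have disj: "set w \<inter> set (join_words a ws) = {} \<longleftrightarrow> (\<forall>v\<in>set ws. set w \<inter> set v = {})"
      by auto
    have "\<forall>y\<in>set (concat ws). a < y" "\<forall>y\<in>set w. a < y" using Cons.prems by auto
    moreover have "\<forall>y\<in>set (join_words a ws). a \<le> y"
      using 1 calculation(1) by (metis DiffI empty_iff insert_iff less_imp_le order.refl)
    ultimately have "nested (join_words a (w # ws)) \<longleftrightarrow>
        nested w \<and> nested (join_words a ws) \<and> set w \<inter> set (join_words a ws) = {}"
      unfolding join_words_Cons[OF False] by (intro nested_append_Cons)
    moreover have "nested (join_words a ws) \<longleftrightarrow> (\<forall>u\<in>set ws. nested u) \<and> disjoint_words ws"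
      using Cons.IH[OF False] Cons.prems by simp
    ultimately show ?thesis unfolding disj by auto
  qed simp
qed simp

section \<open>Subtrees\<close>

text \<open>
  The condition on the subtrees below the root.  The label set is not a parameter: it can be read
  off from the tree, and it shrinks in every recursive step.
\<close>

definition increasing_subtree :: "nat \<Rightarrow> tree \<Rightarrow> bool" where
  "increasing_subtree d T \<longleftrightarrow>
     full_ary d T \<and> distinct (labels T) \<and> (\<forall>p\<in>root_paths T. sorted_wrt (<) p)"

text \<open>
  The number of children is left open because it is \<open>d\<close> at an inner vertex but \<open>d0\<close> at the root;
  everything else is common to both cases.
\<close>

definition increasing_children :: "nat \<Rightarrow> nat \<Rightarrow> tree list \<Rightarrow> bool" where
  "increasing_children d a cs \<longleftrightarrow>
     (\<forall>c\<in>set cs. increasing_subtree d c \<and> (\<forall>x\<in>set (labels c). a < x)) \<and>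
     disjoint_words (map labels cs)"

lemma Union_root_paths: "(\<Union>p\<in>root_paths T. set p) = set (labels T)"
  by (induction T) auto

text \<open>
  The paths below a vertex together visit all labels below it (\<open>Union_root_paths\<close>), so prefixing
  \<open>a\<close> to all of them keeps them increasing exactly if \<open>a\<close> is smaller than all these labels.
\<close>

lemma increasing_vertex_iff:
  "(\<forall>c\<in>set cs. full_ary d c) \<and> distinct (labels (Internal a cs)) \<and>
     (\<forall>p\<in>root_paths (Internal a cs). sorted_wrt (<) p) \<longleftrightarrow> increasing_children d a cs"
proof -
  have "(\<forall>p\<in>root_paths (Internal a cs). sorted_wrt (<) p) \<longleftrightarrow>
    (\<forall>c\<in>set cs. (\<forall>p\<in>root_paths c. sorted_wrt (<) p) \<and> (\<forall>p\<in>root_paths c. \<forall>x\<in>set p. a < x))"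
    by auto
  also have "\<dots> \<longleftrightarrow> (\<forall>c\<in>set cs. (\<forall>p\<in>root_paths c. sorted_wrt (<) p) \<and> (\<forall>x\<in>set (labels c). a < x))"
    unfolding Union_root_paths[symmetric] by blast
  finally show ?thesis
    by (auto simp: increasing_children_def increasing_subtree_def distinct_concat_iff_disjoint_words)
qed

lemma increasing_subtree_External [simp]: "increasing_subtree d External"
  by (simp add: increasing_subtree_def)

lemma increasing_subtree_Internal [simp]:
  "increasing_subtree d (Internal a cs) \<longleftrightarrow> length cs = d \<and> increasing_children d a cs"
  unfolding increasing_vertex_iff[symmetric] increasing_subtree_def full_ary.simps
  by (simp only: conj_ac)

lemma increasing_tree_iff:
  "increasing_tree d d0 X T \<longleftrightarrow>
     (\<exists>cs. T = Internal 0 cs \<and> length cs = d0 \<and> increasing_children d 0 cs) \<and>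
     set (labels T) = insert 0 X"
proof (cases "\<exists>cs. T = Internal 0 cs")
  case True
  then obtain cs where T: "T = Internal 0 cs" by blast
  show ?thesis
    unfolding increasing_tree_def T increasing_vertex_iff[symmetric]
    by (simp add: conj_ac del: labels.simps root_paths.simps)
next
  case False
  then show ?thesis unfolding increasing_tree_def by blast
qed

section \<open>Words of trees\<close>

lemma set_mset_repeat_mset: "set_mset (repeat_mset n M) = (if n = 0 then {} else set_mset M)"
  by (auto simp flip: count_greater_zero_iff)

lemma mset_traversal_word_children:
  assumes "\<And>c. c \<in> set cs \<Longrightarrow> mset (traversal_word c) = repeat_mset \<nu> (mset (labels c))"
  shows "mset (concat (map traversal_word cs)) = repeat_mset \<nu> (mset (concat (map labels cs)))"
  using assms by (induction cs) auto

lemma mset_traversal_word: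
  "full_ary (\<nu> + 1) T \<Longrightarrow> mset (traversal_word T) = repeat_mset \<nu> (mset (labels T))"
proof (induction T)
  case (Internal a cs)
  then have "mset (concat (map traversal_word cs)) = repeat_mset \<nu> (mset (concat (map labels cs)))"
    by (intro mset_traversal_word_children) auto
  moreover have "map traversal_word cs \<noteq> []" "length cs = \<nu> + 1" using Internal.prems by auto
  ultimately show ?case
    by (simp add: mset_join_words del: mset_concat)
qed simp

lemma set_traversal_word:
  assumes "full_ary (\<nu> + 1) T" "\<nu> \<ge> 1"
  shows "set (traversal_word T) = set (labels T)"
proof -
  have "set_mset (mset (traversal_word T)) = set_mset (mset (labels T))"
    unfolding mset_traversal_word[OF assms(1)] using assms(2) by (simp add: set_mset_repeat_mset)
  then show ?thesis by simp
qed

lemma increasing_subtree_set_word: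
  "increasing_subtree (\<nu> + 1) c \<Longrightarrow> \<nu> \<ge> 1 \<Longrightarrow> set (labels c) = set (traversal_word c)"
  using set_traversal_word[of \<nu> c] unfolding increasing_subtree_def by blast

text \<open>
  The conditions that relate different children, and those that relate them to the vertex above,
  depend on label sets only, and label sets can be read off from the words.
\<close>

lemma increasing_children_iff_words:
  assumes "\<nu> \<ge> 1"
  shows "increasing_children (\<nu> + 1) a cs \<longleftrightarrow>
     (\<forall>c\<in>set cs. increasing_subtree (\<nu> + 1) c) \<and>
     (\<forall>w\<in>set (map traversal_word cs). \<forall>x\<in>set w. a < x) \<and>
     disjoint_words (map traversal_word cs)"
proof (cases "\<forall>c\<in>set cs. increasing_subtree (\<nu> + 1) c")
  case True
  then have *: "\<forall>c\<in>set cs. set (labels c) = set (traversal_word c)"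
    using increasing_subtree_set_word assms by blast
  then have "disjoint_words (map labels cs) \<longleftrightarrow> disjoint_words (map traversal_word cs)"
    by (induction cs) auto
  then show ?thesis using * True unfolding increasing_children_def by auto
qed (auto simp: increasing_children_def)

lemma nested_children_word:
  assumes "increasing_children (\<nu> + 1) a cs" "\<nu> \<ge> 1" "cs \<noteq> []"
    and "\<And>c. c \<in> set cs \<Longrightarrow> nested (traversal_word c)"
  shows "nested (join_words a (map traversal_word cs))"
  using assms nested_join_words[of "map traversal_word cs" a]
  unfolding increasing_children_iff_words[OF assms(2)] by auto

lemma nested_traversal_word:
  assumes "\<nu> \<ge> 1"
  shows "increasing_subtree (\<nu> + 1) T \<Longrightarrow> nested (traversal_word T)"
proof (induction T)
  case (Internal a cs)
  then have "increasing_children (\<nu> + 1) a cs" "cs \<noteq> []" by auto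
  moreover have "\<And>c. c \<in> set cs \<Longrightarrow> nested (traversal_word c)"
    using Internal calculation(1) by (auto simp: increasing_children_def)
  ultimately show ?case using nested_children_word[OF _ assms] by simp
qed simp

section \<open>Injectivity\<close>

text \<open>
  The blocks of a word are unique, so injectivity on children gives injectivity one level up.  The
  last premise is the induction hypothesis when this is used inside a tree, and a proved fact when
  it is used at the root.
\<close>

lemma children_determined:
  assumes "\<nu> \<ge> 1" "increasing_children (\<nu> + 1) a cs" "increasing_children (\<nu> + 1) a cs'"
    and "cs \<noteq> []" "cs' \<noteq> []"
    and "join_words a (map traversal_word cs) = join_words a (map traversal_word cs')"
    and "\<And>c c'. c \<in> set cs \<Longrightarrow> increasing_subtree (\<nu> + 1) c \<Longrightarrow> increasing_subtree (\<nu> + 1) c' \<Longrightarrow>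
       traversal_word c = traversal_word c' \<Longrightarrow> c = c'"
  shows "cs = cs'"
proof -
  note children = assms(2,3)[unfolded increasing_children_iff_words[OF assms(1)]]
  have words: "map traversal_word cs = map traversal_word cs'"
    using children assms(4-6) by (intro join_words_inject[of _ _ a]) auto
  then have len: "length cs = length cs'" using map_eq_imp_length_eq by blast
  show ?thesis
  proof (rule nth_equalityI[OF len])
    fix i assume "i < length cs"
    then show "cs ! i = cs' ! i"
      using words len children assms(7)[of "cs ! i" "cs' ! i"] by (metis nth_map nth_mem)
  qed
qed

text \<open>The label at which to cut is determined by the word.\<close>

lemma root_label_Least:
  assumes "\<nu> \<ge> 1" "increasing_subtree (\<nu> + 1) (Internal a cs)"
  shows "(LEAST x. x \<in> set (traversal_word (Internal a cs))) = a"
proof -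
  have "\<forall>x\<in>set (concat (map labels cs)). a < x"
    using assms(2) by (auto simp: increasing_children_def)
  then have "\<forall>x\<in>set (labels (Internal a cs)). a \<le> x" "a \<in> set (labels (Internal a cs))"
    by (auto intro: less_imp_le)
  then have "(LEAST x. x \<in> set (labels (Internal a cs))) = a"
    by (intro Least_equality) blast+
  then show ?thesis by (simp only: increasing_subtree_set_word[OF assms(2,1)])
qed

lemma traversal_word_inject:
  assumes "\<nu> \<ge> 1"
  shows "increasing_subtree (\<nu> + 1) T \<Longrightarrow> increasing_subtree (\<nu> + 1) T' \<Longrightarrow>
    traversal_word T = traversal_word T' \<Longrightarrow> T = T'"
proof (induction T arbitrary: T')
  case External
  then have "set (labels T') = {}"
    using increasing_subtree_set_word[OF _ assms, of T'] by simp
  then show ?case by (cases T') auto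
next
  case (Internal a cs)
  have "set (labels T') \<noteq> {}"
    using increasing_subtree_set_word[OF Internal.prems(1) assms]
      increasing_subtree_set_word[OF Internal.prems(2) assms] Internal.prems(3) by auto
  then obtain a' cs' where T': "T' = Internal a' cs'" by (cases T') auto
  have "a' = a"
    using root_label_Least[OF assms] Internal.prems unfolding T' by metis
  moreover have "cs = cs'"
    using Internal.prems Internal.IH unfolding T' \<open>a' = a\<close>
    by (intro children_determined[OF assms, of a]) auto
  ultimately show ?case using T' by simp
qed

lemma increasing_tree_inject:
  assumes "\<nu> \<ge> 1" "increasing_tree (\<nu> + 1) (t + 1) X T" "increasing_tree (\<nu> + 1) (t + 1) X' T'"
    and "traversal_word T = traversal_word T'"
  shows "T = T'"
proof -
  obtain cs where cs: "T = Internal 0 cs" "length cs = t + 1" "increasing_children (\<nu> + 1) 0 cs"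
    using assms(2) unfolding increasing_tree_iff by (elim conjE exE) (rule that)
  obtain cs' where cs': "T' = Internal 0 cs'" "length cs' = t + 1" "increasing_children (\<nu> + 1) 0 cs'"
    using assms(3) unfolding increasing_tree_iff by (elim conjE exE) (rule that)
  have "cs = cs'"
  proof (rule children_determined[OF assms(1) cs(3) cs'(3)])
    show "cs \<noteq> []" "cs' \<noteq> []" using cs(2) cs'(2) by auto
    show "join_words 0 (map traversal_word cs) = join_words 0 (map traversal_word cs')"
      using assms(4) cs(1) cs'(1) by simp
  qed (rule traversal_word_inject[OF assms(1)])
  then show ?thesis using cs(1) cs'(1) by simp
qed

section \<open>Surjectivity\<close>

text \<open>
  The cutting step: realise all blocks of \<open>w\<close> by subtrees.  The length bound in the premise
  \<open>subtree\<close> makes blocks strictly shorter than \<open>w\<close> when \<open>a\<close> occurs in \<open>w\<close>, as an induction on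
  the length requires; at the root, where \<open>a = 0\<close> may be absent, subtrees for words of any length
  are already available.
\<close>

lemma ex_increasing_children:
  assumes "\<nu> \<ge> 1" "nested w" "\<forall>x\<in>set w. a \<le> x" "\<forall>x\<in>set w - {a}. count (mset w) x = \<nu>"
    and subtree: "\<And>u. nested u \<Longrightarrow> \<forall>x\<in>set u. count (mset u) x = \<nu> \<Longrightarrow>
      length u + count (mset w) a \<le> length w \<Longrightarrow>
      \<exists>c. increasing_subtree (\<nu> + 1) c \<and> traversal_word c = u"
  shows "\<exists>cs. length cs = count (mset w) a + 1 \<and> increasing_children (\<nu> + 1) a cs \<and>
    join_words a (map traversal_word cs) = w"
proof -
  obtain ws where ws: "ws \<noteq> []" "join_words a ws = w" "\<forall>u\<in>set ws. a \<notin> set u"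
    using ex_join_words by blast
  have mset_w: "mset w = replicate_mset (length ws - 1) a + mset (concat ws)"
    using mset_join_words[OF ws(1)] ws(2) by blast
  have count_a: "count (mset w) a = length ws - 1"
  proof -
    have "a \<notin> set (concat ws)" using ws(3) by auto
    then have "count (mset (concat ws)) a = 0" by (metis count_mset_0_iff)
    then show ?thesis using mset_w by simp
  qed
  have set_w: "set (concat ws) \<subseteq> set w"
    using mset_w by (metis mset_subset_eq_add_right set_mset_mono set_mset_mset)
  have above: "\<forall>u\<in>set ws. \<forall>y\<in>set u. a < y"
  proof (intro ballI)
    fix u y assume "u \<in> set ws" "y \<in> set u"
    then have "a \<le> y" "a \<noteq> y" using set_w assms(3) ws(3) by auto
    then show "a < y" by simp
  qed
  have nest: "\<forall>u\<in>set ws. nested u" and disj: "disjoint_words ws"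
    using nested_join_words[OF ws(1) above] ws(2) assms(2) by auto
  have "\<exists>c. increasing_subtree (\<nu> + 1) c \<and> traversal_word c = u" if u: "u \<in> set ws" for u
  proof (rule subtree)
    show "nested u" using nest u by blast
    show "\<forall>x\<in>set u. count (mset u) x = \<nu>"
    proof
      fix x assume x: "x \<in> set u"
      have "x \<in> set w - {a}" using x u set_w ws(3) by auto
      moreover have "count (mset w) x = count (mset (concat ws)) x"
        using mset_w x u ws(3) by auto
      ultimately show "count (mset u) x = \<nu>"
        using count_concat_disjoint_words[OF disj u x] assms(4) by metis
    qed
    have "size (mset w) = (length ws - 1) + length (concat ws)"
      unfolding mset_w by simp
    moreover have "length u \<le> length (concat ws)"
      using u by (simp add: length_concat member_le_sum_list)
    ultimately show "length u + count (mset w) a \<le> length w" using count_a by simp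
  qed
  then have "\<forall>i<length ws. \<exists>c. increasing_subtree (\<nu> + 1) c \<and> traversal_word c = ws ! i" by simp
  then obtain cs where cs: "length cs = length ws"
    "\<forall>i<length ws. increasing_subtree (\<nu> + 1) (cs ! i) \<and> traversal_word (cs ! i) = ws ! i"
    unfolding Skolem_list_nth by blast
  then have words: "map traversal_word cs = ws" by (simp add: list_eq_iff_nth_eq)
  have "increasing_children (\<nu> + 1) a cs"
    unfolding increasing_children_iff_words[OF assms(1)] words
    using cs above disj by (metis in_set_conv_nth)
  moreover have "length cs = count (mset w) a + 1" using count_a cs(1) ws(1) by (cases ws) auto
  ultimately show ?thesis using words ws(2) by blast
qed

lemma ex_increasing_subtree:
  assumes "\<nu> \<ge> 1"
  shows "nested w \<Longrightarrow> \<forall>x\<in>set w. count (mset w) x = \<nu> \<Longrightarrow>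
    \<exists>c. increasing_subtree (\<nu> + 1) c \<and> traversal_word c = w"
proof (induction "length w" arbitrary: w rule: less_induct)
  case less
  show ?case
  proof (cases "w = []")
    case True
    then show ?thesis by (intro exI[of _ External]) simp
  next
    case False
    define a where "a = Min (set w)"
    have a: "a \<in> set w" "\<forall>x\<in>set w. a \<le> x" using False by (auto simp: a_def)
    then have "count (mset w) a = \<nu>" using less.prems by blast
    moreover have "\<exists>cs. length cs = count (mset w) a + 1 \<and> increasing_children (\<nu> + 1) a cs \<and>
      join_words a (map traversal_word cs) = w"
    proof (rule ex_increasing_children[OF assms less.prems(1) a(2)])
      show "\<forall>x\<in>set w - {a}. count (mset w) x = \<nu>" using less.prems(2) by blast
      fix u assume "nested u" "\<forall>x\<in>set u. count (mset u) x = \<nu>"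
        "length u + count (mset w) a \<le> length w"
      then show "\<exists>c. increasing_subtree (\<nu> + 1) c \<and> traversal_word c = u"
        using less.hyps calculation assms by simp
    qed
    ultimately obtain cs where "length cs = \<nu> + 1" "increasing_children (\<nu> + 1) a cs"
      "join_words a (map traversal_word cs) = w" by metis
    then show ?thesis by (intro exI[of _ "Internal a cs"]) simp
  qed
qed

section \<open>Trees, words and forests\<close>

lemma sum_replicate_mset:
  "finite X \<Longrightarrow> (\<Sum>x\<in>X. replicate_mset \<nu> x) = repeat_mset \<nu> (mset_set X)"
  by (induction rule: finite_induct) (auto simp: multiset_eq_iff)

text \<open>
  All letters of a word with the prescribed multiset lie in \<open>insert 0 X\<close>, so restricting the order
  condition to these letters is no restriction.
\<close>

lemma stirling_permutation_iff:
  assumes "finite X"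
  shows "stirling_permutation \<nu> t X w \<longleftrightarrow>
    mset w = replicate_mset t 0 + repeat_mset \<nu> (mset_set X) \<and> nested w"
proof -
  have "w ! i \<in> insert 0 X"
    if "mset w = replicate_mset t 0 + repeat_mset \<nu> (mset_set X)" "i < length w" for i
  proof -
    have "w ! i \<in># replicate_mset t 0 + repeat_mset \<nu> (mset_set X)"
      using that by (metis nth_mem set_mset_mset)
    then have "w ! i \<in># replicate_mset t 0 \<or> w ! i \<in># repeat_mset \<nu> (mset_set X)" by simp
    then show ?thesis using assms by (auto simp: set_mset_repeat_mset split: if_splits)
  qed
  then have "(\<forall>x\<in>insert 0 X. \<forall>i k j. i < k \<and> k < j \<and> j < length w \<and> w ! i = x \<and> w ! j = x
        \<longrightarrow> x \<le> w ! k) \<longleftrightarrow> nested w"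
    if "mset w = replicate_mset t 0 + repeat_mset \<nu> (mset_set X)"
    using that unfolding nested_iff_nth by fastforce
  then show ?thesis
    unfolding stirling_permutation_def sum_replicate_mset[OF assms] by blast
qed

text \<open>
  Without \<open>0 \<notin> X\<close> the two sides would disagree: a tree on \<open>X\<close> has only one vertex labelled \<open>0\<close>,
  so its word has \<open>t\<close> zeros, while a Stirling permutation would have \<open>t + \<nu>\<close>.
\<close>

lemma stirling_permutation_traversal_word:
  assumes "\<nu> \<ge> 1" "finite X" "0 \<notin> X" "increasing_tree (\<nu> + 1) (t + 1) X T"
  shows "stirling_permutation \<nu> t X (traversal_word T)"
proof -
  obtain cs where cs: "T = Internal 0 cs" "length cs = t + 1" "increasing_children (\<nu> + 1) 0 cs"
    and X: "set (labels T) = insert 0 X" and dist: "distinct (labels T)"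
    using assms(4) unfolding increasing_tree_iff
    using assms(4) increasing_tree_def by blast
  have "mset (concat (map labels cs)) = mset_set X"
  proof -
    have "0 \<notin> set (concat (map labels cs))" "distinct (concat (map labels cs))"
      and "insert 0 (set (concat (map labels cs))) = insert 0 X"
      using X dist cs(1) by simp_all
    then have "set (concat (map labels cs)) = X" "distinct (concat (map labels cs))"
      using assms(3) by (metis insert_ident)+
    then show ?thesis by (metis mset_set_set)
  qed
  moreover have "mset (concat (map traversal_word cs)) = repeat_mset \<nu> (mset (concat (map labels cs)))"
    using cs(3) by (intro mset_traversal_word_children mset_traversal_word)
      (auto simp: increasing_children_def increasing_subtree_def)
  ultimately have "mset (traversal_word T) = replicate_mset t 0 + repeat_mset \<nu> (mset_set X)"
    using cs(1,2) mset_join_words[of "map traversal_word cs" 0] by (cases "cs = []") auto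
  moreover have "nested (traversal_word T)"
  proof -
    have "cs \<noteq> []" using cs(2) by auto
    moreover have "nested (traversal_word c)" if "c \<in> set cs" for c
      using nested_traversal_word[OF assms(1)] cs(3) that unfolding increasing_children_def by blast
    ultimately show ?thesis
      using nested_children_word[OF cs(3) assms(1)] cs(1) by simp
  qed
  ultimately show ?thesis unfolding stirling_permutation_iff[OF assms(2)] by blast
qed

lemma ex_increasing_tree:
  assumes "\<nu> \<ge> 1" "finite X" "0 \<notin> X" "stirling_permutation \<nu> t X w"
  shows "\<exists>T. increasing_tree (\<nu> + 1) (t + 1) X T \<and> traversal_word T = w"
proof -
  have w: "mset w = replicate_mset t 0 + repeat_mset \<nu> (mset_set X)" "nested w"
    using assms(4) unfolding stirling_permutation_iff[OF assms(2)] by auto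
  have count0: "count (mset w) 0 = t" unfolding w(1) using assms(3) by simp
  have count: "count (mset w) x = (if x \<in> X then \<nu> else 0)" if "x \<noteq> 0" for x
    unfolding w(1) using that assms(2) by (simp add: count_mset_set')
  have "\<exists>cs. length cs = count (mset w) 0 + 1 \<and> increasing_children (\<nu> + 1) 0 cs \<and>
      join_words 0 (map traversal_word cs) = w"
  proof (rule ex_increasing_children[OF assms(1) w(2)])
    show "\<forall>x\<in>set w - {0}. count (mset w) x = \<nu>"
    proof
      fix x assume x: "x \<in> set w - {0}"
      then have "count (mset w) x \<noteq> 0" by simp
      then show "count (mset w) x = \<nu>" using count x by (metis DiffE insertI1)
    qed
  qed (use ex_increasing_subtree[OF assms(1)] in auto)
  then obtain cs where cs: "length cs = t + 1" "increasing_children (\<nu> + 1) 0 cs"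
      "join_words 0 (map traversal_word cs) = w" unfolding count0 by blast
  have "set (concat (map labels cs)) = X"
  proof -
    have "mset (concat (map traversal_word cs)) = repeat_mset \<nu> (mset_set X)"
      using mset_join_words[of "map traversal_word cs" 0] cs(1,3) w(1)
      by (cases "cs = []") auto
    then have "set (concat (map traversal_word cs)) = set_mset (repeat_mset \<nu> (mset_set X))"
      by (metis set_mset_mset)
    also have "\<dots> = X" using assms(1,2) by (simp add: set_mset_repeat_mset)
    moreover have "set (concat (map labels cs)) = set (concat (map traversal_word cs))"
      using cs(2) increasing_subtree_set_word[OF _ assms(1)] by (auto simp: increasing_children_def)
    ultimately show ?thesis by simp
  qed
  then have "increasing_tree (\<nu> + 1) (t + 1) X (Internal 0 cs)"
    using cs unfolding increasing_tree_iff by simp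
  then show ?thesis using cs(3) by (intro exI[of _ "Internal 0 cs"]) simp
qed

lemma gen_ordered_partition_part:
  assumes "gen_ordered_partition s n Xs" "i < s"
  shows "finite (Xs ! i)" "0 \<notin> Xs ! i"
proof -
  have "Xs ! i \<subseteq> {1..n}"
    using assms unfolding gen_ordered_partition_def by (metis Union_upper nth_mem)
  then show "finite (Xs ! i)" "0 \<notin> Xs ! i" by (auto intro: finite_subset)
qed

theorem theorem11:
  fixes \<nu> s t n :: nat and ts :: "nat list"
  assumes "\<nu> \<ge> 1" and "s \<ge> 1" and "length ts = s" and "sum_list ts = t"
  shows "bij_betw (map traversal_word)
           (increasing_forests (\<nu> + 1) (map (\<lambda>k. k + 1) ts) n)
           (stirling_permutations \<nu> ts n)"
proof -
  let ?F = "increasing_forests (\<nu> + 1) (map (\<lambda>k. k + 1) ts) n"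
  have forest: "Ts \<in> ?F \<longleftrightarrow> length Ts = length ts \<and>
    (\<exists>Xs. gen_ordered_partition (length ts) n Xs \<and>
      (\<forall>i<length ts. increasing_tree (\<nu> + 1) (ts ! i + 1) (Xs ! i) (Ts ! i)))" for Ts
    by (simp add: increasing_forests_def)
  have "inj_on (map traversal_word) ?F"
  proof (rule inj_onI)
    fix Ts Us assume *: "Ts \<in> ?F" "Us \<in> ?F" "map traversal_word Ts = map traversal_word Us"
    show "Ts = Us"
    proof (rule nth_equalityI)
      show len: "length Ts = length Us" using *(3) map_eq_imp_length_eq by blast
      fix i assume "i < length Ts"
      moreover from this have "traversal_word (Ts ! i) = traversal_word (Us ! i)"
        using *(3) len by (metis nth_map)
      ultimately show "Ts ! i = Us ! i"
        using *(1,2) unfolding forest by (metis increasing_tree_inject[OF assms(1)])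
    qed
  qed
  moreover have "map traversal_word ` ?F = stirling_permutations \<nu> ts n"
  proof (intro equalityI subsetI)
    fix ws assume "ws \<in> map traversal_word ` ?F"
    then obtain Ts where "Ts \<in> ?F" and ws: "ws = map traversal_word Ts" by blast
    then obtain Xs where Ts: "length Ts = length ts"
      and Xs: "gen_ordered_partition (length ts) n Xs"
      and trees: "\<forall>i<length ts. increasing_tree (\<nu> + 1) (ts ! i + 1) (Xs ! i) (Ts ! i)"
      unfolding forest by blast
    have "\<forall>i<length ts. stirling_permutation \<nu> (ts ! i) (Xs ! i) (ws ! i)"
      using stirling_permutation_traversal_word[OF assms(1)] gen_ordered_partition_part[OF Xs]
        trees Ts ws by simp
    then show "ws \<in> stirling_permutations \<nu> ts n"
      using Ts ws Xs unfolding stirling_permutations_def by auto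
  next
    fix ws assume "ws \<in> stirling_permutations \<nu> ts n"
    then obtain Xs where len: "length ws = length ts"
      and Xs: "gen_ordered_partition (length ts) n Xs"
      and words: "\<forall>i<length ts. stirling_permutation \<nu> (ts ! i) (Xs ! i) (ws ! i)"
      unfolding stirling_permutations_def by blast
    have "\<forall>i<length ts. \<exists>T. increasing_tree (\<nu> + 1) (ts ! i + 1) (Xs ! i) T \<and> traversal_word T = ws ! i"
      using ex_increasing_tree[OF assms(1)] gen_ordered_partition_part[OF Xs] words by blast
    then obtain Ts where Ts: "length Ts = length ts"
      "\<forall>i<length ts. increasing_tree (\<nu> + 1) (ts ! i + 1) (Xs ! i) (Ts ! i) \<and>
        traversal_word (Ts ! i) = ws ! i"
      unfolding Skolem_list_nth by blast
    then have "Ts \<in> ?F" unfolding forest using Xs by blast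
    moreover have "ws = map traversal_word Ts" using Ts len by (simp add: list_eq_iff_nth_eq)
    ultimately show "ws \<in> map traversal_word ` ?F" by blast
  qed
  ultimately show ?thesis unfolding bij_betw_def ..
qed

end
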